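(* Let $s\ge1$ and $n\ge1$ be integers, let $p,q\in(0,1)$ satisfy $\sum_{k=0}^{s}p^kq^{s-k}=1$, and let $X\sim\mathcal{B}^{(s)}(n,p)$ follow the bi$^s$nomial distribution. Then the expectation and variance of $X$ are $$E(X)=np\,\frac{(s+1)p^{s}-1}{p-q},\qquad V(X)=npq\,\frac{1-(s+1)^2(pq)^s}{(p-q)^2}\qquad\text{if }p\neq q,$$ and $$E(X)=\frac{sn}{2},\qquad V(X)=\frac{sn(s+2)}{12}\qquad\text{if }p=q.$$
   Context: For integers $n\ge 1$, $s\ge1$, $k\ge0$, the bi$^s$nomial coefficient $\binom{n}{k}_s$ is the number of integer solutions $(x_1,\dots,x_n)$ of $x_1+\cdots+x_n=k$ with $0\le x_i\le s$ for all $i$; equivalently, the coefficient of $x^k$ in $(1+x+\cdots+x^s)^n$. The bi$^s$nomial distribution $\mathcal{B}^{(s)}(n,p)$, where $p,q\in(0,1)$ satisfy $\sum_{k=0}^s p^kq^{s-k}=1$, is the law on $\{0,\dots,sn\}$ with $\mathbb{P}(X=k)=\binom{n}{k}_s p^kq^{sn-k}$. *)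

theory Defs
  imports "HOL-Probability.Probability"
begin

text \<open>The solutions \<open>(x\<^sub>1, \<dots>, x\<^sub>n)\<close> are extensional functions on \<open>{1..n}\<close>
  (undefined elsewhere), so that each solution is counted exactly once.\<close>

definition bisnomial :: "nat \<Rightarrow> nat \<Rightarrow> nat \<Rightarrow> nat" where
  "bisnomial s n k = card {x \<in> {1..n} \<rightarrow>\<^sub>E {0..s}. (\<Sum>i = 1..n. x i) = k}"

definition has_bisnomial_distribution ::
    "nat \<Rightarrow> nat \<Rightarrow> real \<Rightarrow> real \<Rightarrow> 'a measure \<Rightarrow> ('a \<Rightarrow> nat) \<Rightarrow> bool" where
  "has_bisnomial_distribution s n p q M X \<longleftrightarrow>
     X \<in> measurable M (count_space UNIV) \<and>
     (\<forall>k. measure M {\<omega> \<in> space M. X \<omega> = k} =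
        (if k \<le> s * n then real (bisnomial s n k) * p ^ k * q ^ (s * n - k) else 0))"

end

theory Submission
  imports Defs
begin

text \<open>The probability generating function of \<open>X\<close> is \<open>g ^ n\<close>, where
  \<open>g\<close> is the polynomial with coefficients \<open>p ^ j * q ^ (s - j)\<close>, so \<open>X\<close> is distributed like the
  sum of \<open>n\<close> independent variables with generating function \<open>g\<close>. The Euler operator
  \<open>x d/dx\<close> is a derivation and multiplies the \<open>k\<close>-th coefficient by \<open>k\<close>;
  applying it once and twice to \<open>g ^ n\<close> and evaluating at \<open>1\<close> gives the first two moments of \<open>X\<close>
  in terms of those of \<open>g\<close>. For \<open>p \<noteq> q\<close> the latter have a closed form after multiplication
  by \<open>p - q\<close>, which simplifies because \<open>p ^ (s + 1) - q ^ (s + 1) = p - q\<close>.\<close>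

section \<open>Euler operator and moments read off from a generating polynomial\<close>

definition euler_op :: "'a::{comm_semiring_1,semiring_no_zero_divisors} poly \<Rightarrow> 'a poly" where
  "euler_op f = pCons 0 (pderiv f)"

lemma coeff_euler_op: "coeff (euler_op f) k = of_nat k * coeff f k"
  by (cases k) (simp_all add: euler_op_def coeff_pderiv)

lemma euler_op_mult: "euler_op (f * g) = f * euler_op g + g * euler_op f"
  by (simp add: euler_op_def pderiv_mult)

lemma euler_op_add: "euler_op (f + g) = euler_op f + euler_op g"
  by (simp add: euler_op_def pderiv_add)

lemma degree_euler_op_le: "degree (euler_op f) \<le> degree f"
  by (rule degree_le) (simp add: coeff_euler_op coeff_eq_0)

text \<open>A bound \<open>N\<close> in place of the exact degree lets the same index range serve
  \<open>f\<close> and its images under \<open>euler_op\<close>.\<close>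

lemma poly_1_eq_sum_coeff:
  fixes f :: "'a::comm_semiring_1 poly"
  assumes "degree f \<le> N"
  shows "poly f 1 = (\<Sum>k\<le>N. coeff f k)"
  using arg_cong[OF poly_as_sum_of_monoms'[OF assms], of "\<lambda>f. poly f 1"]
  by (simp add: poly_sum poly_monom)

lemma poly_euler_op_1:
  assumes "degree f \<le> N"
  shows "poly (euler_op f) 1 = (\<Sum>k\<le>N. of_nat k * coeff f k)"
  using poly_1_eq_sum_coeff[OF order.trans[OF degree_euler_op_le assms]]
  by (simp add: coeff_euler_op)

lemma poly_euler_op_euler_op_1:
  assumes "degree f \<le> N"
  shows "poly (euler_op (euler_op f)) 1 = (\<Sum>k\<le>N. of_nat k ^ 2 * coeff f k)"
  using poly_euler_op_1[OF order.trans[OF degree_euler_op_le assms]]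
  by (simp add: coeff_euler_op power2_eq_square mult.assoc)

text \<open>By the product rule each of the \<open>n\<close> factors contributes once, and the
  undifferentiated factors evaluate to 1.\<close>

lemma poly_euler_op_power_1:
  fixes g :: "real poly"
  assumes "poly g 1 = 1"
  shows "poly (euler_op (g ^ n)) 1 = n * poly (euler_op g) 1"
  by (induction n) (simp_all add: assms euler_op_mult algebra_simps, simp add: euler_op_def)

text \<open>The two applications hit either the same factor, in \<open>n\<close> ways, or two
  distinct factors, in \<open>n * (n - 1)\<close> ordered ways.\<close>

lemma poly_euler_op_euler_op_power_1:
  fixes g :: "real poly"
  assumes "poly g 1 = 1"
  shows "poly (euler_op (euler_op (g ^ n))) 1 =
    n * poly (euler_op (euler_op g)) 1 + n * (real n - 1) * poly (euler_op g) 1 ^ 2"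
proof (induction n)
  case 0
  then show ?case by (simp add: euler_op_def)
next
  case (Suc n)
  then show ?case
    by (simp add: assms euler_op_mult euler_op_add poly_euler_op_power_1)
      (simp add: algebra_simps power2_eq_square)
qed

section \<open>Generating function of the distribution\<close>

definition bisnomial_gf :: "nat \<Rightarrow> real \<Rightarrow> real \<Rightarrow> real poly" where
  "bisnomial_gf s p q = (\<Sum>j = 0..s. monom (p ^ j * q ^ (s - j)) j)"

lemma coeff_bisnomial_gf:
  "coeff (bisnomial_gf s p q) k = (if k \<le> s then p ^ k * q ^ (s - k) else 0)"
  by (simp add: bisnomial_gf_def coeff_sum)

lemma degree_bisnomial_gf_le: "degree (bisnomial_gf s p q) \<le> s"
  by (rule degree_le) (simp add: coeff_bisnomial_gf)

lemma degree_bisnomial_gf_power_le: "degree (bisnomial_gf s p q ^ n) \<le> s * n"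
  using degree_power_le[of "bisnomial_gf s p q" n] mult_le_mono1[OF degree_bisnomial_gf_le]
  by (rule order.trans)

lemma prod_monom: "(\<Prod>i\<in>I. monom (c i) (d i)) = monom (\<Prod>i\<in>I. c i) (\<Sum>i\<in>I. d i)"
  by (induction I rule: infinite_finite_induct) (simp_all add: mult_monom)

text \<open>Expanding the product of \<open>n\<close> sums gives one monomial per choice function
  \<open>x\<close>; both its degree and its coefficient depend only on the sum of the
  \<open>x i\<close>, so counting the \<open>x\<close> with sum \<open>k\<close> suffices.\<close>

lemma coeff_bisnomial_gf_power:
  "coeff (bisnomial_gf s p q ^ n) k = real (bisnomial s n k) * p ^ k * q ^ (s * n - k)"
proof -
  let ?E = "{1..n} \<rightarrow>\<^sub>E {0..s}"
  have fin: "finite ?E" by (simp add: finite_PiE)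
  have weight: "(\<Prod>i = 1..n. p ^ x i * q ^ (s - x i)) =
      p ^ (\<Sum>i = 1..n. x i) * q ^ (s * n - (\<Sum>i = 1..n. x i))" if "x \<in> ?E" for x
  proof -
    \<comment> \<open>No natural subtraction truncates, because \<open>x i \<le> s\<close>
      throughout.\<close>
    have "(\<Sum>i = 1..n. s - x i) = s * n - (\<Sum>i = 1..n. x i)"
      using that by (subst sum_subtractf_nat) (auto simp: mult.commute)
    then show ?thesis
      by (simp add: prod.distrib flip: power_sum)
  qed
  have "bisnomial_gf s p q ^ n = (\<Prod>i = 1..n. \<Sum>j = 0..s. monom (p ^ j * q ^ (s - j)) j)"
    by (simp add: bisnomial_gf_def)
  also have "\<dots> = (\<Sum>x\<in>?E. \<Prod>i = 1..n. monom (p ^ x i * q ^ (s - x i)) (x i))"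
    by (subst prod_sum_PiE) simp_all
  also have "\<dots> = (\<Sum>x\<in>?E. monom (p ^ (\<Sum>i = 1..n. x i) * q ^ (s * n - (\<Sum>i = 1..n. x i)))
      (\<Sum>i = 1..n. x i))"
    by (intro sum.cong refl) (simp only: prod_monom weight)
  finally have "coeff (bisnomial_gf s p q ^ n) k =
      (\<Sum>x\<in>?E. if (\<Sum>i = 1..n. x i) = k then p ^ k * q ^ (s * n - k) else 0)"
    by (simp only: coeff_sum coeff_monom) (intro sum.cong, auto)
  also have "\<dots> = real (bisnomial s n k) * p ^ k * q ^ (s * n - k)"
    by (subst sum.inter_filter[OF fin, symmetric]) (simp add: bisnomial_def)
  finally show ?thesis .
qed

section \<open>From the distribution to expectation and variance\<close>

lemma (in prob_space) has_bochner_integral_finite_nat: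
  fixes f :: "nat \<Rightarrow> real"
  assumes X: "X \<in> measurable M (count_space UNIV)"
    and zero: "\<And>k. k > N \<Longrightarrow> prob {\<omega> \<in> space M. X \<omega> = k} = 0"
  shows "has_bochner_integral M (\<lambda>\<omega>. f (X \<omega>)) (\<Sum>k\<le>N. f k * prob {\<omega> \<in> space M. X \<omega> = k})"
proof -
  have sets: "{\<omega> \<in> space M. X \<omega> = k} \<in> events" for k
    using X by measurable
  have "AE \<omega> in M. X \<omega> \<noteq> k" if "k > N" for k
    using zero[OF that] sets[of k] by (subst (asm) prob_eq_0) auto
  \<comment> \<open>Countably many null events have a null union, so \<open>X\<close> is almost
    surely bounded by \<open>N\<close>.\<close>
  then have "AE \<omega> in M. \<forall>k. k > N \<longrightarrow> X \<omega> \<noteq> k"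
    by (subst AE_all_countable) auto
  then have le: "AE \<omega> in M. X \<omega> \<le> N"
    by eventually_elim (metis not_less)
  have "has_bochner_integral M
      (\<lambda>\<omega>. \<Sum>k\<le>N. f k * indicator {\<omega> \<in> space M. X \<omega> = k} \<omega>)
      (\<Sum>k\<le>N. f k * prob {\<omega> \<in> space M. X \<omega> = k})"
    using sets
    by (intro has_bochner_integral_sum has_bochner_integral_mult_right
        has_bochner_integral_real_indicator) (auto simp: emeasure_eq_measure)
  \<comment> \<open>Where \<open>X \<omega> \<le> N\<close>, only the summand with
    \<open>k = X \<omega>\<close> survives.\<close>
  moreover have "AE \<omega> in M. (\<Sum>k\<le>N. f k * indicator {\<omega> \<in> space M. X \<omega> = k} \<omega>) = f (X \<omega>)"
    using le AE_space
  proof eventually_elim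
    case (elim \<omega>)
    have "(\<Sum>k\<le>N. f k * indicator {\<omega> \<in> space M. X \<omega> = k} \<omega>) =
        (\<Sum>k\<le>N. if k = X \<omega> then f (X \<omega>) else 0)"
      using elim by (intro sum.cong) (auto simp: indicator_def)
    then show ?case using elim by simp
  qed
  moreover have "(\<lambda>\<omega>. f (X \<omega>)) \<in> borel_measurable M"
    using X by measurable
  ultimately show ?thesis
    by (subst has_bochner_integral_cong_AE[symmetric]) auto
qed

text \<open>Subtracting \<open>(n * m1) ^ 2\<close> from the second moment
  \<open>n * m2 + n * (n - 1) * m1 ^ 2\<close> leaves \<open>n\<close> times the variance of a
  single summand.\<close>

lemma bisnomial_expectation_variance:
  assumes g: "poly (bisnomial_gf s p q) 1 = 1"
    and M: "prob_space M" and dist: "has_bisnomial_distribution s n p q M X"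
  defines "m1 \<equiv> poly (euler_op (bisnomial_gf s p q)) 1"
    and "m2 \<equiv> poly (euler_op (euler_op (bisnomial_gf s p q))) 1"
  shows "prob_space.expectation M (\<lambda>\<omega>. real (X \<omega>)) = n * m1"
    and "prob_space.variance M (\<lambda>\<omega>. real (X \<omega>)) = n * (m2 - m1 ^ 2)"
proof -
  interpret prob_space M by fact
  let ?G = "bisnomial_gf s p q ^ n"
  have X: "X \<in> measurable M (count_space UNIV)"
    and P: "k \<le> s * n \<Longrightarrow> prob {\<omega> \<in> space M. X \<omega> = k} = coeff ?G k" for k
    using dist by (simp_all add: has_bisnomial_distribution_def coeff_bisnomial_gf_power)
  have zero: "prob {\<omega> \<in> space M. X \<omega> = k} = 0" if "k > s * n" for k
    using dist that by (simp add: has_bisnomial_distribution_def)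
  have E: "has_bochner_integral M (\<lambda>\<omega>. f (X \<omega>)) (\<Sum>k\<le>s * n. f k * coeff ?G k)" for f :: "nat \<Rightarrow> real"
    using has_bochner_integral_finite_nat[where N = "s * n" and f = f, OF X zero] by (simp add: P)
  have E1: "has_bochner_integral M (\<lambda>\<omega>. real (X \<omega>)) (n * m1)"
    using E[of real]
    by (simp add: m1_def poly_euler_op_power_1[OF g, symmetric]
        poly_euler_op_1[OF degree_bisnomial_gf_power_le])
  have E2: "has_bochner_integral M (\<lambda>\<omega>. (real (X \<omega>))\<^sup>2) (n * m2 + n * (real n - 1) * m1 ^ 2)"
    using E[of "\<lambda>k. (real k)\<^sup>2"]
    by (simp add: m1_def m2_def poly_euler_op_euler_op_power_1[OF g, symmetric]
        poly_euler_op_euler_op_1[OF degree_bisnomial_gf_power_le])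
  show exp: "expectation (\<lambda>\<omega>. real (X \<omega>)) = n * m1"
    using E1 by (rule has_bochner_integral_integral_eq)
  have "variance (\<lambda>\<omega>. real (X \<omega>)) =
      expectation (\<lambda>\<omega>. (real (X \<omega>))\<^sup>2) - (expectation (\<lambda>\<omega>. real (X \<omega>)))\<^sup>2"
    using E1 E2 by (intro variance_eq) (auto intro: integrable.intros)
  then show "variance (\<lambda>\<omega>. real (X \<omega>)) = n * (m2 - m1 ^ 2)"
    using has_bochner_integral_integral_eq[OF E2]
    by (simp add: exp algebra_simps power2_eq_square)
qed

section \<open>Weighted homogeneous geometric sums\<close>

lemma sum_geometric_homogeneous_Suc:
  fixes p q :: "'a::comm_ring_1"
  shows "(\<Sum>k\<le>Suc s. a k * (p ^ k * q ^ (Suc s - k))) =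
    q * (\<Sum>k\<le>s. a k * (p ^ k * q ^ (s - k))) + a (Suc s) * p ^ Suc s"
  by (simp add: sum_distrib_left Suc_diff_le mult_ac)

lemmas sum_geometric_homogeneous_Suc_1 =
  sum_geometric_homogeneous_Suc[of "\<lambda>_. 1", unfolded mult_1]

lemma sum_geometric_homogeneous:
  fixes p q :: "'a::comm_ring_1"
  shows "(p - q) * (\<Sum>k\<le>s. p ^ k * q ^ (s - k)) = p ^ Suc s - q ^ Suc s"
proof (induction s)
  case (Suc s)
  have "(p - q) * (\<Sum>k\<le>Suc s. p ^ k * q ^ (Suc s - k)) =
      q * ((p - q) * (\<Sum>k\<le>s. p ^ k * q ^ (s - k))) + (p - q) * p ^ Suc s"
    by (simp only: sum_geometric_homogeneous_Suc_1) (simp only: algebra_simps)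
  also have "\<dots> = p ^ Suc (Suc s) - q ^ Suc (Suc s)"
    unfolding Suc by (simp add: algebra_simps)
  finally show ?case .
qed simp

text \<open>This is what \<open>p d/dp\<close> makes of \<open>sum_geometric_homogeneous\<close>;
  induction on \<open>s\<close> gives it over any commutative ring without differentiating.\<close>

lemma sum_geometric_homogeneous_moment1:
  fixes p q :: "'a::comm_ring_1"
  shows "(p - q) * (\<Sum>k\<le>s. of_nat k * (p ^ k * q ^ (s - k))) =
    p * (of_nat (Suc s) * p ^ s - (\<Sum>k\<le>s. p ^ k * q ^ (s - k)))"
proof (induction s)
  case (Suc s)
  have "(p - q) * (\<Sum>k\<le>Suc s. of_nat k * (p ^ k * q ^ (Suc s - k))) =
      q * ((p - q) * (\<Sum>k\<le>s. of_nat k * (p ^ k * q ^ (s - k))))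
        + (p - q) * of_nat (Suc s) * p ^ Suc s"
    by (simp only: sum_geometric_homogeneous_Suc) (simp only: algebra_simps)
  also have "\<dots> = p * (of_nat (Suc (Suc s)) * p ^ Suc s -
      (q * (\<Sum>k\<le>s. p ^ k * q ^ (s - k)) + p ^ Suc s))"
    unfolding Suc by (simp add: algebra_simps)
  finally show ?case
    by (simp only: sum_geometric_homogeneous_Suc_1)
qed simp

text \<open>A second application of \<open>p d/dp\<close>, now to the first-moment identity, yields
  this form.\<close>

lemma sum_geometric_homogeneous_moment2:
  fixes p q :: "'a::comm_ring_1"
  shows "(p - q) * (\<Sum>k\<le>s. of_nat k ^ 2 * (p ^ k * q ^ (s - k))) =
    p * (of_nat (Suc s) ^ 2 * p ^ s - 2 * (\<Sum>k\<le>s. of_nat k * (p ^ k * q ^ (s - k)))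
      - (\<Sum>k\<le>s. p ^ k * q ^ (s - k)))"
proof (induction s)
  case (Suc s)
  have "(p - q) * (\<Sum>k\<le>Suc s. of_nat k ^ 2 * (p ^ k * q ^ (Suc s - k))) =
      q * ((p - q) * (\<Sum>k\<le>s. of_nat k ^ 2 * (p ^ k * q ^ (s - k))))
        + (p - q) * of_nat (Suc s) ^ 2 * p ^ Suc s"
    by (simp only: sum_geometric_homogeneous_Suc) (simp only: algebra_simps)
  also have "\<dots> = p * (of_nat (Suc (Suc s)) ^ 2 * p ^ Suc s
      - 2 * (q * (\<Sum>k\<le>s. of_nat k * (p ^ k * q ^ (s - k))) + of_nat (Suc s) * p ^ Suc s)
      - (q * (\<Sum>k\<le>s. p ^ k * q ^ (s - k)) + p ^ Suc s))"
    unfolding Suc by (simp add: algebra_simps power2_eq_square)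
  finally show ?case
    by (simp only: sum_geometric_homogeneous_Suc sum_geometric_homogeneous_Suc_1)
qed simp

lemma sum_of_nat_squares: "(\<Sum>k\<le>s. real k ^ 2) = real s * (real s + 1) * (2 * real s + 1) / 6"
  by (induction s) (simp_all add: field_simps power2_eq_square)

theorem corollary4p1:
  fixes s n :: nat and p q :: real and M :: "'a measure" and X :: "'a \<Rightarrow> nat"
  assumes "s \<ge> 1" and "n \<ge> 1"
    and "p \<in> {0<..<1}" and "q \<in> {0<..<1}"
    and "(\<Sum>k=0..s. p ^ k * q ^ (s - k)) = 1"
    and "prob_space M"
    and "has_bisnomial_distribution s n p q M X"
  shows "(p \<noteq> q \<longrightarrow>
            prob_space.expectation M (\<lambda>\<omega>. real (X \<omega>)) =
              real n * p * (((real s + 1) * p ^ s - 1) / (p - q)) \<and>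
            prob_space.variance M (\<lambda>\<omega>. real (X \<omega>)) =
              real n * p * q * ((1 - (real s + 1)\<^sup>2 * (p * q) ^ s) / (p - q)\<^sup>2)) \<and>
         (p = q \<longrightarrow>
            prob_space.expectation M (\<lambda>\<omega>. real (X \<omega>)) = real s * real n / 2 \<and>
            prob_space.variance M (\<lambda>\<omega>. real (X \<omega>)) =
              real s * real n * (real s + 2) / 12)"
proof -
  let ?g = "bisnomial_gf s p q"
  let ?S = "\<Sum>k\<le>s. p ^ k * q ^ (s - k)"
  define m1 where "m1 = poly (euler_op ?g) 1"
  define m2 where "m2 = poly (euler_op (euler_op ?g)) 1"
  have S: "?S = 1"
    using assms(5) by (simp add: atLeast0AtMost)
  have g: "poly ?g 1 = 1"
    using S by (simp add: poly_1_eq_sum_coeff[OF degree_bisnomial_gf_le] coeff_bisnomial_gf)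
  have m1: "m1 = (\<Sum>k\<le>s. real k * (p ^ k * q ^ (s - k)))"
    unfolding m1_def by (simp add: poly_euler_op_1[OF degree_bisnomial_gf_le] coeff_bisnomial_gf)
  have m2: "m2 = (\<Sum>k\<le>s. real k ^ 2 * (p ^ k * q ^ (s - k)))"
    unfolding m2_def
    by (simp add: poly_euler_op_euler_op_1[OF degree_bisnomial_gf_le] coeff_bisnomial_gf)
  note moments = bisnomial_expectation_variance[OF g assms(6,7), folded m1_def m2_def]
  show ?thesis
  proof (intro conjI[OF impI impI])
    assume "p \<noteq> q"
    have pq: "p ^ Suc s - q ^ Suc s = p - q"
      using sum_geometric_homogeneous[of p q s] S by simp
    have r1: "(p - q) * m1 = p * ((real s + 1) * p ^ s - 1)"
      using sum_geometric_homogeneous_moment1[of p q s] by (simp add: m1 S add.commute)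
    have r2: "(p - q) * m2 = p * ((real s + 1) ^ 2 * p ^ s - 2 * m1 - 1)"
      using sum_geometric_homogeneous_moment2[of p q s] by (simp add: m1 m2 S add.commute)
    \<comment> \<open>The factor \<open>(p - q)\<^sup>2\<close> is distributed so that
      \<open>r1\<close> and \<open>r2\<close> apply without any division.\<close>
    have "(p - q)\<^sup>2 * (m2 - m1\<^sup>2) = (p - q) * ((p - q) * m2) - ((p - q) * m1)\<^sup>2"
      by (simp add: algebra_simps power2_eq_square)
    also have "\<dots> = p * ((p - q) * ((real s + 1)\<^sup>2 * p ^ s) - 2 * ((p - q) * m1) - (p - q))
        - ((p - q) * m1)\<^sup>2"
      unfolding r2 by (simp add: algebra_simps)
    \<comment> \<open>The terms linear in \<open>real s + 1\<close> cancel.\<close>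
    also have "\<dots> = p * q + (real s + 1)\<^sup>2 * p ^ Suc s * (p - q - p ^ Suc s)"
      unfolding r1 by (simp add: algebra_simps power2_eq_square)
    \<comment> \<open>By \<open>pq\<close> the last factor is \<open>- q ^ Suc s\<close>, which
      pairs with \<open>p ^ Suc s\<close>.\<close>
    also have "\<dots> = p * q * (1 - (real s + 1)\<^sup>2 * (p * q) ^ s)"
      unfolding pq[symmetric] by (simp add: algebra_simps power_mult_distrib)
    finally have v: "(p - q)\<^sup>2 * (m2 - m1\<^sup>2) = p * q * (1 - (real s + 1)\<^sup>2 * (p * q) ^ s)" .
    have "m1 = p * ((real s + 1) * p ^ s - 1) / (p - q)"
      using r1 \<open>p \<noteq> q\<close> by (simp add: eq_divide_eq mult.commute)
    moreover have "m2 - m1\<^sup>2 = p * q * (1 - (real s + 1)\<^sup>2 * (p * q) ^ s) / (p - q)\<^sup>2"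
      using v \<open>p \<noteq> q\<close> by (simp add: eq_divide_eq mult.commute)
    ultimately show "prob_space.expectation M (\<lambda>\<omega>. real (X \<omega>)) =
          real n * p * (((real s + 1) * p ^ s - 1) / (p - q)) \<and>
        prob_space.variance M (\<lambda>\<omega>. real (X \<omega>)) =
          real n * p * q * ((1 - (real s + 1)\<^sup>2 * (p * q) ^ s) / (p - q)\<^sup>2)"
      by (intro conjI moments(1)[THEN trans] moments(2)[THEN trans]) simp_all
  next
    assume "p = q"
    \<comment> \<open>All weights coincide, so a single summand is uniform on \<open>{0..s}\<close>;
      \<open>ps\<close> records that each weight is \<open>1 / (s + 1)\<close>.\<close>
    then have w: "p ^ k * q ^ (s - k) = p ^ s" if "k \<le> s" for k
      using that by (simp flip: power_add)
    have ps: "(real s + 1) * p ^ s = 1"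
      using S by (simp add: w add.commute)
    have "m1 = (\<Sum>k\<le>s. real k) * p ^ s"
      by (simp add: m1 w sum_distrib_right)
    also have "(\<Sum>k\<le>s. real k) = real s * (real s + 1) / 2"
      by (induction s) (simp_all add: field_simps)
    \<comment> \<open>The factor is grouped so that \<open>ps\<close> replaces it by 1;
      \<open>m2\<close> is treated likewise.\<close>
    finally have "m1 = real s / 2 * ((real s + 1) * p ^ s)"
      by simp
    then have m1': "m1 = real s / 2"
      by (simp only: ps mult_1_right)
    have "m2 = (\<Sum>k\<le>s. real k ^ 2) * p ^ s"
      by (simp add: m2 w sum_distrib_right)
    then have "m2 = real s * (2 * real s + 1) / 6 * ((real s + 1) * p ^ s)"
      by (simp add: sum_of_nat_squares)
    then have m2': "m2 = real s * (2 * real s + 1) / 6"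
      by (simp only: ps mult_1_right)
    \<comment> \<open>The variance rests on
      \<open>s * (2 * s + 1) / 6 - s ^ 2 / 4 = s * (s + 2) / 12\<close>.\<close>
    show "prob_space.expectation M (\<lambda>\<omega>. real (X \<omega>)) = real s * real n / 2 \<and>
        prob_space.variance M (\<lambda>\<omega>. real (X \<omega>)) = real s * real n * (real s + 2) / 12"
      by (intro conjI moments(1)[THEN trans] moments(2)[THEN trans])
        (simp_all add: m1' m2' field_simps power2_eq_square)
  qed
qed

end
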